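(* Let $D$ be an arc-colored digraph on $n\geq 3$ vertices. If \[a(D)+c(D)\geq\begin{cases} n(n-1)+\lfloor\frac{n^{2}}{4}\rfloor+3,&\text{if } n=3, 4;\\ n(n-1)+\lfloor\frac{n^{2}}{4}\rfloor+2,&\text{if } n\geq 5, \end{cases}\] then $D$ contains a rainbow triangle.
   Context: All digraphs are finite, without loops or multiple arcs (opposite arcs $xy,yx$ allowed). $a(D)$ is the number of arcs of $D$. An arc-coloring is any map $C:A(D)\to\mathbb{N}$; $c(D)$ is the number of distinct colors used on the arcs. A rainbow triangle is a directed cycle of length 3 whose arcs have pairwise distinct colors. *)

theory Defs
  imports Main
begin

definition digraph :: "'a set \<Rightarrow> ('a \<times> 'a) set \<Rightarrow> bool" where
  "digraph V A \<longleftrightarrow> finite V \<and> A \<subseteq> V \<times> V \<and> (\<forall>x. (x, x) \<notin> A)"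

definition num_colors :: "('a \<times> 'a) set \<Rightarrow> ('a \<times> 'a \<Rightarrow> nat) \<Rightarrow> nat" where
  "num_colors A C = card (C ` A)"

definition has_rainbow_triangle :: "('a \<times> 'a) set \<Rightarrow> ('a \<times> 'a \<Rightarrow> nat) \<Rightarrow> bool" where
  "has_rainbow_triangle A C \<longleftrightarrow>
     (\<exists>x y z. (x, y) \<in> A \<and> (y, z) \<in> A \<and> (z, x) \<in> A \<and>
        C (x, y) \<noteq> C (y, z) \<and> C (y, z) \<noteq> C (z, x) \<and> C (x, y) \<noteq> C (z, x))"

end

theory Submission
  imports Defs
begin

text \<open>
  Suppose there is no rainbow triangle, and let \<open>a\<close> and \<open>c\<close> be the numbers of arcs and colours.

  For \<open>n \<le> 5\<close> count the \<open>n (n - 1) (n - 2)\<close> ordered triples of distinct vertices, each read as a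
  cyclically directed triangle. A triple contains a non-arc or two arcs of one colour class. If
  \<open>M\<close> is a class of \<open>m\<close> arcs, double counting gives
  \<open>2 \<cdot> #(triples with at least two arcs in M) + #(triples with an odd number) = 3 (n - 2) m\<close>.
  Over GF(2) an arc set meeting almost all triangles evenly is empty or large, so for
  \<open>0 < m < 2, 4, 8\<close> (\<open>n = 3, 4, 5\<close>) at least \<open>3 (n - 2)\<close> triples are odd. As the class sizes
  minus one sum to \<open>a - c\<close>, at most one class is larger than that, and the count contradicts
  the assumed lower bound on \<open>a + c\<close>.

  For \<open>n \<ge> 6\<close> average over all vertex deletions: every arc, and some arc of every colour, survives
  \<open>n - 2\<close> of them, so \<open>(n - 2) (a + c) \<le> n B\<close> where \<open>B\<close> bounds the case \<open>n - 1\<close>. This suffices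
  unless \<open>n = 7\<close> and equality holds. Then every colour class lies within a 2-cycle, so there is no
  directed triangle at all and the digraph has at most 26 arcs, too few.
\<close>

section \<open>Ordered triples and arc sets\<close>

text \<open>The triples do not depend on the arcs, so non-arcs can be counted in the same way as
  colour classes. Each cyclically directed triangle occurs as its three rotations.\<close>

definition triples :: "'a set \<Rightarrow> ('a \<times> 'a \<times> 'a) set" where
  "triples V = {(x, y, z). x \<in> V \<and> y \<in> V \<and> z \<in> V \<and> x \<noteq> y \<and> y \<noteq> z \<and> z \<noteq> x}"

fun hits :: "('a \<times> 'a) set \<Rightarrow> 'a \<times> 'a \<times> 'a \<Rightarrow> nat" where
  "hits M (x, y, z) = of_bool ((x, y) \<in> M) + of_bool ((y, z) \<in> M) + of_bool ((z, x) \<in> M)"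

definition odd_triples :: "'a set \<Rightarrow> ('a \<times> 'a) set \<Rightarrow> nat" where
  "odd_triples V M = card {t \<in> triples V. odd (hits M t)}"

definition double_triples :: "'a set \<Rightarrow> ('a \<times> 'a) set \<Rightarrow> nat" where
  "double_triples V M = card {t \<in> triples V. 2 \<le> hits M t}"

lemma card_filter_eq_sum_of_bool:
  "finite S \<Longrightarrow> card {x \<in> S. P x} = (\<Sum>x\<in>S. of_bool (P x))"
  by (simp add: of_bool_def sum.If_cases Int_def)

lemma finite_triples: "finite V \<Longrightarrow> finite (triples V)"
  by (rule finite_subset[of _ "V \<times> V \<times> V"]) (auto simp: triples_def)

lemma digraph_finite_arcs: "digraph V A \<Longrightarrow> finite A"
  unfolding digraph_def by (meson finite_SigmaI finite_subset)

lemma digraph_subset: "digraph V A \<Longrightarrow> M \<subseteq> A \<Longrightarrow> digraph V M"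
  unfolding digraph_def by blast

lemma card_triples_with_arc:
  assumes "digraph V M" "card V = n"
  shows "card {(x, y, z) \<in> triples V. (x, y) \<in> M} = (n - 2) * card M"
proof -
  let ?S = "SIGMA p:M. V - {fst p, snd p}"
  have fin: "finite V" "finite M"
    using assms digraph_finite_arcs by (auto simp: digraph_def)
  have "bij_betw (\<lambda>((x, y), z). (x, y, z)) ?S {(x, y, z) \<in> triples V. (x, y) \<in> M}"
    using assms
    by (intro bij_betw_byWitness[where f' = "\<lambda>(x, y, z). ((x, y), z)"])
      (auto simp: triples_def digraph_def)
  then have "card {(x, y, z) \<in> triples V. (x, y) \<in> M} = card ?S"
    by (rule bij_betw_same_card[symmetric])
  also have "\<dots> = (\<Sum>p\<in>M. card (V - {fst p, snd p}))"
    using fin by simp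
  also have "\<dots> = (\<Sum>p\<in>M. n - 2)"
  proof (rule sum.cong)
    fix p assume "p \<in> M"
    then have "{fst p, snd p} \<subseteq> V" "fst p \<noteq> snd p"
      using assms by (auto simp: digraph_def)
    then show "card (V - {fst p, snd p}) = n - 2"
      using assms by (subst card_Diff_subset) auto
  qed simp
  finally show ?thesis by simp
qed

lemma card_triples_rotate:
  "card {(x, y, z) \<in> triples V. P y z x} = card {(x, y, z) \<in> triples V. P x y z}"
  by (intro bij_betw_same_card[of "\<lambda>(x, y, z). (y, z, x)"]
      bij_betw_byWitness[where f' = "\<lambda>(x, y, z). (z, x, y)"]) (auto simp: triples_def)

lemma sum_hits:
  assumes "digraph V M" "card V = n"
  shows "(\<Sum>t\<in>triples V. hits M t) = 3 * ((n - 2) * card M)"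
proof -
  have fin: "finite (triples V)"
    using assms finite_triples by (auto simp: digraph_def)
  note cnt = card_filter_eq_sum_of_bool[OF fin, symmetric]
  have "(\<Sum>t\<in>triples V. hits M t) =
      (\<Sum>t\<in>triples V. of_bool (case t of (x, y, z) \<Rightarrow> (x, y) \<in> M)
        + of_bool (case t of (x, y, z) \<Rightarrow> (y, z) \<in> M)
        + of_bool (case t of (x, y, z) \<Rightarrow> (z, x) \<in> M))"
    by (rule sum.cong) auto
  also have "\<dots> = card {(x, y, z) \<in> triples V. (x, y) \<in> M}
      + card {(x, y, z) \<in> triples V. (y, z) \<in> M} + card {(x, y, z) \<in> triples V. (z, x) \<in> M}"
    by (simp only: sum.distrib cnt) (simp add: case_prod_unfold)
  finally show ?thesis
    using card_triples_rotate[of V "\<lambda>x y z. (x, y) \<in> M"]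
      card_triples_rotate[of V "\<lambda>x y z. (y, z) \<in> M"] card_triples_with_arc[OF assms]
    by simp
qed

text \<open>The identity holds triple by triple: for h = 0, 1, 2, 3 hits, twice [h >= 2] plus
  [h odd] equals h. Summation then uses \<open>sum_hits\<close>.\<close>

lemma double_odd_triples:
  assumes "digraph V M" "card V = n"
  shows "2 * double_triples V M + odd_triples V M = 3 * ((n - 2) * card M)"
proof -
  have fin: "finite (triples V)"
    using assms finite_triples by (auto simp: digraph_def)
  have "2 * double_triples V M + odd_triples V M =
      (\<Sum>t\<in>triples V. 2 * of_bool (2 \<le> hits M t) + of_bool (odd (hits M t)))"
    unfolding double_triples_def odd_triples_def using fin
    by (simp add: sum.distrib of_bool_def sum.If_cases Int_def flip: sum_distrib_left)
  also have "\<dots> = (\<Sum>t\<in>triples V. hits M t)"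
  proof (rule sum.cong)
    fix t :: "'a \<times> 'a \<times> 'a"
    obtain x y z where t: "t = (x, y, z)" by (cases t)
    show "2 * of_bool (2 \<le> hits M t) + of_bool (odd (hits M t)) = hits M t"
      unfolding t
      by (cases "(x, y) \<in> M"; cases "(y, z) \<in> M"; cases "(z, x) \<in> M") simp_all
  qed simp
  finally show ?thesis
    using sum_hits[OF assms] by simp
qed

text \<open>Rotation permutes the three arcs of a triple, so the odd triples split into rotation
  orbits, of size 3 because the vertices are distinct.\<close>

lemma three_dvd_odd_triples:
  assumes "finite V"
  shows "3 dvd odd_triples V M"
proof -
  let ?S = "{t \<in> triples V. odd (hits M t)}"
  let ?orb = "\<lambda>(x, y, z). {(x, y, z), (y, z, x), (z, x, y)}"
  have U: "\<Union> (?orb ` ?S) = ?S"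
    by (auto simp: triples_def)
  have "3 * card (?orb ` ?S) = card (\<Union> (?orb ` ?S))"
  proof (rule card_partition)
    show "finite (?orb ` ?S)" "finite (\<Union> (?orb ` ?S))"
      unfolding U using finite_triples[OF assms] by auto
    show "card c = 3" if "c \<in> ?orb ` ?S" for c
      using that by (auto simp: triples_def)
    show "c1 \<inter> c2 = {}" if "c1 \<in> ?orb ` ?S" "c2 \<in> ?orb ` ?S" "c1 \<noteq> c2" for c1 c2
      using that by (auto simp: triples_def)
  qed
  then show ?thesis
    unfolding odd_triples_def U by (rule dvdI[OF sym])
qed

lemma card_arcs:
  assumes "finite V" "card V = n"
  shows "card {(x, y). x \<in> V \<and> y \<in> V \<and> x \<noteq> y} = n * (n - 1)"
proof -
  have "{(x, y). x \<in> V \<and> y \<in> V \<and> x \<noteq> y} = (SIGMA x:V. V - {x})" by auto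
  then show ?thesis using assms by simp
qed

lemma card_digraph_le:
  assumes "digraph V A" "card V = n"
  shows "card A \<le> n * (n - 1)"
proof -
  have "finite V" "A \<subseteq> {(x, y). x \<in> V \<and> y \<in> V \<and> x \<noteq> y}"
    using assms by (auto simp: digraph_def)
  moreover from this have "finite {(x, y). x \<in> V \<and> y \<in> V \<and> x \<noteq> y}"
    by (auto intro: finite_subset[of _ "V \<times> V"])
  ultimately show ?thesis
    using card_arcs[of V n] assms card_mono[of "{(x, y). x \<in> V \<and> y \<in> V \<and> x \<noteq> y}" A] by simp
qed

section \<open>Arc sets meeting almost every triangle an even number of times\<close>

text \<open>The variable \<open>xy\<close> stands for membership of the arc from x to y. All eight
  directed triangles on four vertices are met evenly, so the six arcs at a determine the rest. A
  directed 4-cycle attains the bound.\<close>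

lemma triangle_even_4_bool:
  fixes ab ba ac ca ad da bc cb bd db cd dc :: bool
  assumes
    "ab = (bc \<noteq> ca)" "ac = (cb \<noteq> ba)" "ab = (bd \<noteq> da)" "ad = (db \<noteq> ba)"
    "ac = (cd \<noteq> da)" "ad = (dc \<noteq> ca)" "bc = (cd \<noteq> db)" "bd = (dc \<noteq> cb)"
    "ab \<or> ba \<or> ac \<or> ca \<or> ad \<or> da \<or> bc \<or> cb \<or> bd \<or> db \<or> cd \<or> dc"
  shows "(4::nat) \<le> of_bool ab + of_bool ba + of_bool ac + of_bool ca + of_bool ad + of_bool da
    + of_bool bc + of_bool cb + of_bool bd + of_bool db + of_bool cd + of_bool dc"
  using assms
  by (cases ba; cases ca; cases da; cases ab; cases ac; cases ad; simp)

text \<open>The first twelve equations are the triangles through a, solved for the arc off a; the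
  next six are those through b but not a. The two triangles on c, d, e stay unconstrained.\<close>

lemma triangle_even_5_bool:
  fixes ab ba ac ca ad da ae ea bc cb bd db be eb cd dc ce ec de ed :: bool
  assumes
    "bc = (ab \<noteq> ca)" "cb = (ac \<noteq> ba)" "bd = (ab \<noteq> da)" "db = (ad \<noteq> ba)"
    "be = (ab \<noteq> ea)" "eb = (ae \<noteq> ba)" "cd = (ac \<noteq> da)" "dc = (ad \<noteq> ca)"
    "ce = (ac \<noteq> ea)" "ec = (ae \<noteq> ca)" "de = (ad \<noteq> ea)" "ed = (ae \<noteq> da)"
    "bc = (cd \<noteq> db)" "bd = (dc \<noteq> cb)" "bc = (ce \<noteq> eb)" "be = (ec \<noteq> cb)"
    "bd = (de \<noteq> eb)" "be = (ed \<noteq> db)"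
    "ab \<or> ba \<or> ac \<or> ca \<or> ad \<or> da \<or> ae \<or> ea \<or> bc \<or> cb \<or> bd \<or> db \<or> be \<or> eb
      \<or> cd \<or> dc \<or> ce \<or> ec \<or> de \<or> ed"
  shows "(8::nat) \<le> of_bool ab + of_bool ba + of_bool ac + of_bool ca + of_bool ad + of_bool da
    + of_bool ae + of_bool ea + of_bool bc + of_bool cb + of_bool bd + of_bool db + of_bool be
    + of_bool eb + of_bool cd + of_bool dc + of_bool ce + of_bool ec + of_bool de + of_bool ed"
  proof -
  \<comment> \<open>Let s_x be \<open>ax\<close> xor \<open>xa\<close>. Eliminating the arcs off a,
    the triangles on bcd, bce, bde give s_b + s_c + s_d = s_b + s_c + s_e = s_b + s_d + s_e = 0 mod
    2. Hence s_b = 0 and s_c = s_d = s_e, which leaves five free bits.\<close>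
  have "ab = ba" using assms(1-18) by sat
  moreover have "(ac = ca) = (ad = da)" using assms(1-18) by sat
  moreover have "(ac = ca) = (ae = ea)" using assms(1-18) by sat
  ultimately show ?thesis using assms
    by (cases ba; cases ca; cases da; cases ea; cases ac; simp)
qed

lemma odd_triples_eq_0:
  assumes "finite V" "odd_triples V M = 0" "x \<in> V" "y \<in> V" "z \<in> V" "x \<noteq> y" "y \<noteq> z" "z \<noteq> x"
  shows "even (hits M (x, y, z))"
  using assms finite_triples[OF assms(1)] by (auto simp: odd_triples_def triples_def)

lemma even_hits_iff:
  "even (hits M (x, y, z)) \<longleftrightarrow> ((x, y) \<in> M) = (((y, z) \<in> M) \<noteq> ((z, x) \<in> M))"
  by (cases "(x, y) \<in> M"; cases "(y, z) \<in> M"; cases "(z, x) \<in> M") simp_all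

lemma card_eq_sum_of_bool:
  assumes "finite S" "M \<subseteq> S"
  shows "card M = (\<Sum>p\<in>S. of_bool (p \<in> M))"
  using card_filter_eq_sum_of_bool[OF assms(1), of "\<lambda>p. p \<in> M"] assms(2)
  by (simp add: Collect_conj_eq Int_absorb1)

lemma triangle_even_4:
  assumes V: "V = {a, b, c, d}" "distinct [a, b, c, d]"
    and M: "digraph V M" "M \<noteq> {}"
    and ev: "\<And>x y z. x \<in> V \<Longrightarrow> y \<in> V \<Longrightarrow> z \<in> V \<Longrightarrow> x \<noteq> y \<Longrightarrow> y \<noteq> z \<Longrightarrow> z \<noteq> x
      \<Longrightarrow> even (hits M (x, y, z))"
  shows "4 \<le> card M"
proof -
  let ?S = "{(a, b), (b, a), (a, c), (c, a), (a, d), (d, a), (b, c), (c, b), (b, d), (d, b),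
    (c, d), (d, c)}"
  have sub: "M \<subseteq> ?S"
  proof
    fix p assume "p \<in> M"
    then obtain x y where "p = (x, y)" "x \<noteq> y" "x \<in> V" "y \<in> V"
      using M(1) by (cases p) (auto simp: digraph_def)
    then show "p \<in> ?S"
      unfolding V(1) by (elim insertE emptyE) simp_all
  qed
  obtain p where p: "p \<in> M"
    using M(2) by blast
  with sub have "p \<in> ?S" ..
  with p have ne: "(a, b) \<in> M \<or> (b, a) \<in> M \<or> (a, c) \<in> M \<or> (c, a) \<in> M \<or> (a, d) \<in> M \<or> (d, a) \<in> M
    \<or> (b, c) \<in> M \<or> (c, b) \<in> M \<or> (b, d) \<in> M \<or> (d, b) \<in> M \<or> (c, d) \<in> M \<or> (d, c) \<in> M"
    by (elim insertE emptyE) simp_all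
  have ev': "((x, y) \<in> M) = (((y, z) \<in> M) \<noteq> ((z, x) \<in> M))"
    if "x \<in> V" "y \<in> V" "z \<in> V" "distinct [x, y, z]" for x y z
    using that ev[of x y z] unfolding even_hits_iff by auto
  have "4 \<le> (of_bool ((a, b) \<in> M) + of_bool ((b, a) \<in> M) + of_bool ((a, c) \<in> M) + of_bool ((c, a) \<in> M)
    + of_bool ((a, d) \<in> M) + of_bool ((d, a) \<in> M) + of_bool ((b, c) \<in> M) + of_bool ((c, b) \<in> M)
    + of_bool ((b, d) \<in> M) + of_bool ((d, b) \<in> M) + of_bool ((c, d) \<in> M) + of_bool ((d, c) \<in> M) :: nat)"
    by (rule triangle_even_4_bool[OF ev' ev' ev' ev' ev' ev' ev' ev' ne]) (use V in auto)
  also have "\<dots> = (\<Sum>p\<in>?S. of_bool (p \<in> M))"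
  proof -
    have "sum g ?S = g (a, b) + g (b, a) + g (a, c) + g (c, a)
    + g (a, d) + g (d, a) + g (b, c) + g (c, b)
    + g (b, d) + g (d, b) + g (c, d) + g (d, c)" for g :: "_ \<Rightarrow> nat"
      using V(2) by simp
    then show ?thesis by (rule sym)
  qed
  also have "\<dots> = card M"
    by (rule card_eq_sum_of_bool[symmetric]) (use sub in auto)
  finally show ?thesis .
qed

text \<open>The triangles on \<open>{c, d, e}\<close> are exempt because evenness will be known only
  for triangles avoiding at least one of these three vertices.\<close>

lemma triangle_even_5:
  assumes V: "V = {a, b, c, d, e}" "distinct [a, b, c, d, e]"
    and M: "digraph V M" "M \<noteq> {}"
    and ev: "\<And>x y z. x \<in> V \<Longrightarrow> y \<in> V \<Longrightarrow> z \<in> V \<Longrightarrow> x \<noteq> y \<Longrightarrow> y \<noteq> z \<Longrightarrow> z \<noteq> x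
      \<Longrightarrow> {x, y, z} \<noteq> {c, d, e} \<Longrightarrow> even (hits M (x, y, z))"
  shows "8 \<le> card M"
proof -
  let ?S = "{(a, b), (b, a), (a, c), (c, a), (a, d), (d, a), (a, e), (e, a), (b, c), (c, b),
    (b, d), (d, b), (b, e), (e, b), (c, d), (d, c), (c, e), (e, c), (d, e), (e, d)}"
  have sub: "M \<subseteq> ?S"
  proof
    fix p assume "p \<in> M"
    then obtain x y where "p = (x, y)" "x \<noteq> y" "x \<in> V" "y \<in> V"
      using M(1) by (cases p) (auto simp: digraph_def)
    then show "p \<in> ?S"
      unfolding V(1) by (elim insertE emptyE) simp_all
  qed
  obtain p where p: "p \<in> M"
    using M(2) by blast
  with sub have "p \<in> ?S" ..
  with p have ne: "(a, b) \<in> M \<or> (b, a) \<in> M \<or> (a, c) \<in> M \<or> (c, a) \<in> M \<or> (a, d) \<in> M \<or> (d, a) \<in> M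
    \<or> (a, e) \<in> M \<or> (e, a) \<in> M \<or> (b, c) \<in> M \<or> (c, b) \<in> M \<or> (b, d) \<in> M \<or> (d, b) \<in> M
    \<or> (b, e) \<in> M \<or> (e, b) \<in> M \<or> (c, d) \<in> M \<or> (d, c) \<in> M \<or> (c, e) \<in> M \<or> (e, c) \<in> M
    \<or> (d, e) \<in> M \<or> (e, d) \<in> M"
    by (elim insertE emptyE) simp_all
  \<comment> \<open>Evenness is solved for the arc off \<open>a\<close>, the shape of the first
    twelve premises of \<open>triangle_even_5_bool\<close>.\<close>
  have ea: "((y, z) \<in> M) = (((a, y) \<in> M) \<noteq> ((z, a) \<in> M))"
    if "y \<in> V" "z \<in> V" "distinct [a, y, z]" for y z
  proof -
    have "{a, y, z} \<noteq> {c, d, e}" using V by auto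
    then show ?thesis
      using that V(1) ev[of a y z] unfolding even_hits_iff by auto
  qed
  have eb: "((b, y) \<in> M) = (((y, z) \<in> M) \<noteq> ((z, b) \<in> M))"
    if "y \<in> V" "z \<in> V" "distinct [b, y, z]" for y z
  proof -
    have "{b, y, z} \<noteq> {c, d, e}" using V by auto
    then show ?thesis
      using that V(1) ev[of b y z] unfolding even_hits_iff by auto
  qed
  have "8 \<le> (of_bool ((a, b) \<in> M) + of_bool ((b, a) \<in> M) + of_bool ((a, c) \<in> M)
    + of_bool ((c, a) \<in> M) + of_bool ((a, d) \<in> M) + of_bool ((d, a) \<in> M)
    + of_bool ((a, e) \<in> M) + of_bool ((e, a) \<in> M) + of_bool ((b, c) \<in> M)
    + of_bool ((c, b) \<in> M) + of_bool ((b, d) \<in> M) + of_bool ((d, b) \<in> M)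
    + of_bool ((b, e) \<in> M) + of_bool ((e, b) \<in> M) + of_bool ((c, d) \<in> M)
    + of_bool ((d, c) \<in> M) + of_bool ((c, e) \<in> M) + of_bool ((e, c) \<in> M)
    + of_bool ((d, e) \<in> M) + of_bool ((e, d) \<in> M) :: nat)"
    by (rule triangle_even_5_bool[OF ea ea ea ea ea ea ea ea ea ea ea ea eb eb eb eb eb eb ne])
      (use V in auto)
  also have "\<dots> = (\<Sum>p\<in>?S. of_bool (p \<in> M))"
  proof -
    have "sum g ?S = g (a, b) + g (b, a) + g (a, c) + g (c, a)
    + g (a, d) + g (d, a) + g (a, e) + g (e, a)
    + g (b, c) + g (c, b) + g (b, d) + g (d, b)
    + g (b, e) + g (e, b) + g (c, d) + g (d, c)
    + g (c, e) + g (e, c) + g (d, e) + g (e, d)" for g :: "_ \<Rightarrow> nat"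
      using V(2) by simp
    then show ?thesis by (rule sym)
  qed
  also have "\<dots> = card M"
    by (rule card_eq_sum_of_bool[symmetric]) (use sub in auto)
  finally show ?thesis .
qed

section \<open>Lower bounds for the number of odd triples\<close>

lemma odd_triples_restrict:
  "odd_triples W (M \<inter> W \<times> W) = odd_triples W M"
  unfolding odd_triples_def by (rule arg_cong[where f = card]) (auto simp: triples_def)

text \<open>With four vertices the right-hand side of \<open>double_odd_triples\<close> is 6 times
  the number of arcs, so the number of odd triples is even; it is also divisible by 3. Arcs leaving
  \<open>W\<close> hit no triple.\<close>

lemma six_dvd_odd_triples:
  assumes "card W = 4" "\<forall>x. (x, x) \<notin> M"
  shows "6 dvd odd_triples W M"
proof -
  have fin: "finite W" using assms(1) by (metis card.infinite zero_neq_numeral)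
  have "digraph W (M \<inter> W \<times> W)"
    using fin assms by (auto simp: digraph_def)
  from double_odd_triples[OF this assms(1)] have "even (odd_triples W M)"
    unfolding odd_triples_restrict by presburger
  with three_dvd_odd_triples[OF fin, of M] show ?thesis
    by presburger
qed

text \<open>A triple survives exactly the deletions of the \<open>card V - 3\<close> vertices
  outside it, and its parity is unaffected.\<close>

lemma sum_odd_triples_delete:
  assumes "finite V"
  shows "(\<Sum>v\<in>V. odd_triples (V - {v}) M) = (card V - 3) * odd_triples V M"
proof -
  let ?T = "{t \<in> triples V. odd (hits M t)}"
  let ?av = "\<lambda>v t. case t of (x, y, z) \<Rightarrow> v \<noteq> x \<and> v \<noteq> y \<and> v \<noteq> z"
  have fin: "finite ?T" using finite_triples[OF assms] by simp
  have "(\<Sum>v\<in>V. odd_triples (V - {v}) M) = (\<Sum>v\<in>V. card {t \<in> ?T. ?av v t})"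
    unfolding odd_triples_def
    by (intro sum.cong arg_cong[where f = card]) (auto simp: triples_def)
  also have "\<dots> = (\<Sum>v\<in>V. \<Sum>t\<in>?T. of_bool (?av v t))"
    by (simp only: card_filter_eq_sum_of_bool[OF fin])
  also have "\<dots> = (\<Sum>t\<in>?T. \<Sum>v\<in>V. of_bool (?av v t))"
    by (rule sum.swap)
  also have "\<dots> = (\<Sum>t\<in>?T. card V - 3)"
  proof (rule sum.cong)
    fix t assume t: "t \<in> ?T"
    obtain x y z where xyz: "t = (x, y, z)" by (cases t)
    have "(\<Sum>v\<in>V. of_bool (?av v t)) = card (V - {x, y, z})"
      unfolding xyz card_filter_eq_sum_of_bool[OF assms, symmetric]
      by (intro arg_cong[where f = card]) auto
    also have "\<dots> = card V - 3"
      using t assms unfolding xyz by (subst card_Diff_subset) (auto simp: triples_def)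
    finally show "(\<Sum>v\<in>V. of_bool (?av v t)) = card V - 3" .
  qed simp
  finally show ?thesis
    by (simp add: odd_triples_def)
qed

text \<open>\<open>M\<close> is a single arc; completing it by the third vertex gives a triple hit
  once, and divisibility by 3 does the rest.\<close>

lemma odd_triples_3:
  assumes "card V = 3" "digraph V M" "M \<noteq> {}" "card M < 2"
  shows "3 \<le> odd_triples V M"
proof -
  have fin: "finite V" using assms(2) by (simp add: digraph_def)
  obtain x y where M: "M = {(x, y)}"
    using assms(3,4) digraph_finite_arcs[OF assms(2)]
    by (metis One_nat_def card_0_eq card_1_singletonE less_2_cases surj_pair)
  then have xy: "x \<in> V" "y \<in> V" "x \<noteq> y"
    using assms(2) by (auto simp: digraph_def)
  then have "card (V - {x, y}) = 1"
    using assms(1) by (subst card_Diff_subset) auto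
  then obtain z where "z \<in> V" "z \<noteq> x" "z \<noteq> y"
    by (metis DiffD1 DiffD2 card_1_singletonE insertCI)
  then have "odd_triples V M \<noteq> 0"
    using odd_triples_eq_0[OF fin, of M x y z] xy M by auto
  with three_dvd_odd_triples[OF fin, of M] show ?thesis
    using dvd_imp_le by blast
qed

text \<open>By divisibility, fewer than 6 odd triples means none, which
  \<open>triangle_even_4\<close> excludes.\<close>

lemma odd_triples_4:
  assumes "card V = 4" "digraph V M" "M \<noteq> {}" "card M < 4"
  shows "6 \<le> odd_triples V M"
proof (rule ccontr)
  assume "\<not> 6 \<le> odd_triples V M"
  with six_dvd_odd_triples[of V M] have 0: "odd_triples V M = 0"
    using assms by (auto simp: digraph_def dest: dvd_imp_le)
  have fin: "finite V" using assms(2) by (simp add: digraph_def)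
  obtain vs where "set vs = V" "distinct vs" "length vs = 4"
    using fin assms(1) by (metis distinct_card finite_distinct_list)
  then obtain a b c d where "V = {a, b, c, d}" "distinct [a, b, c, d]"
    by (auto simp: numeral_eq_Suc length_Suc_conv)
  from triangle_even_4[OF this assms(2,3) odd_triples_eq_0[OF fin 0]] show False
    using assms(4) by simp
qed

text \<open>With few odd triples, at most two vertex deletions can leave any, since each such
  deletion leaves at least 6. The other three vertices serve as c, d, e in
  \<open>triangle_even_5\<close>.\<close>

lemma odd_triples_5:
  assumes "card V = 5" "digraph V M" "M \<noteq> {}" "card M < 8"
  shows "9 \<le> odd_triples V M"
proof (rule ccontr)
  assume less: "\<not> 9 \<le> odd_triples V M"
  have fin: "finite V" using assms(2) by (simp add: digraph_def)
  let ?Z = "{v \<in> V. odd_triples (V - {v}) M = 0}"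
  have "6 \<le> odd_triples (V - {v}) M" if "v \<in> V - ?Z" for v
    using six_dvd_odd_triples[of "V - {v}" M] that assms
    by (auto simp: digraph_def dest: dvd_imp_le)
  then have "6 * card (V - ?Z) \<le> (\<Sum>v\<in>V - ?Z. odd_triples (V - {v}) M)"
    using sum_mono[of "V - ?Z" "\<lambda>_. 6" "\<lambda>v. odd_triples (V - {v}) M"] by simp
  also have "\<dots> \<le> (\<Sum>v\<in>V. odd_triples (V - {v}) M)"
    using fin by (intro sum_mono2) auto
  \<comment> \<open>Each odd triple is counted \<open>5 - 3 = 2\<close> times, and there are at most
    8 of them.\<close>
  also have "\<dots> < 18"
    using sum_odd_triples_delete[OF fin, of M] assms(1) less by simp
  finally have "card (V - ?Z) < 3" by simp
  then have "3 \<le> card ?Z"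
    using assms(1) fin card_Diff_subset[of ?Z V] by simp
  then obtain W where "W \<subseteq> ?Z" "card W = 3"
    using obtain_subset_with_card_n[of 3 ?Z] by blast
  then obtain c d e where W: "W = {c, d, e}" "distinct [c, d, e]"
    by (auto simp: card_3_iff)
  have "card (V - W) = 2"
    using \<open>W \<subseteq> ?Z\<close> \<open>card W = 3\<close> assms(1) fin by (subst card_Diff_subset) (auto intro: finite_subset)
  then obtain a b where ab: "V - W = {a, b}" "a \<noteq> b"
    by (auto simp: card_2_iff)
  have V: "V = {a, b, c, d, e}" "distinct [a, b, c, d, e]"
    using ab W \<open>W \<subseteq> ?Z\<close> by auto
  have "8 \<le> card M"
  proof (rule triangle_even_5[OF V assms(2,3)])
    fix x y z
    assume xyz: "x \<in> V" "y \<in> V" "z \<in> V" "x \<noteq> y" "y \<noteq> z" "z \<noteq> x" "{x, y, z} \<noteq> {c, d, e}"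
    \<comment> \<open>The triple misses some \<open>w\<close> in \<open>W\<close>, so it lies in
      \<open>V - {w}\<close>, which has no odd triples.\<close>
    have "\<not> W \<subseteq> {x, y, z}"
      using card_subset_eq[of "{x, y, z}" W] xyz \<open>card W = 3\<close> W(1) by auto
    then obtain w where "w \<in> W" "w \<notin> {x, y, z}" by blast
    then show "even (hits M (x, y, z))"
      using odd_triples_eq_0[of "V - {w}" M x y z] xyz fin \<open>W \<subseteq> ?Z\<close> by auto
  qed
  then show False using assms(4) by simp
qed

section \<open>At most five vertices\<close>

lemma card_triples:
  assumes "finite V" "card V = n"
  shows "card (triples V) = (n - 2) * (n * (n - 1))"
proof -
  let ?K = "{(x, y). x \<in> V \<and> y \<in> V \<and> x \<noteq> y}"
  have "triples V = {(x, y, z) \<in> triples V. (x, y) \<in> ?K}"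
    by (auto simp: triples_def)
  moreover have "digraph V ?K"
    using assms(1) by (auto simp: digraph_def)
  ultimately show ?thesis
    using card_triples_with_arc[of V ?K n] card_arcs[OF assms] assms(2) by simp
qed

text \<open>Every triple either uses a non-arc or meets some colour class twice. The hypothesis on
  \<open>w\<close> costs a class smaller than \<open>w\<close> enough odd triples to gain a full unit of \<open>card M\<close> over
  the trivial bound for \<open>double_triples\<close>, and there is room for one larger class only.\<close>

lemma arcs_plus_colors_le:
  assumes A: "digraph V A" and n: "card V = n" "3 \<le> n"
    and nr: "\<not> has_rainbow_triangle A C"
    and w: "\<And>M. digraph V M \<Longrightarrow> M \<noteq> {} \<Longrightarrow> card M < w \<Longrightarrow> 3 * (n - 2) \<le> odd_triples V M"
    and few: "card A < num_colors A C + 2 * (w - 1)"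
  shows "3 * (card A + num_colors A C) \<le> 4 * (n * (n - 1)) + 3"
proof -
  let ?K = "{(x, y). x \<in> V \<and> y \<in> V \<and> x \<noteq> y}"
  let ?N = "?K - A"
  define r where "r = n - 2"
  define cls where "cls k = {p \<in> A. C p = k}" for k
  define q where "q = card {k \<in> C ` A. w \<le> card (cls k)}"
  have finV: "finite V" and finA: "finite A"
    using A digraph_finite_arcs by (auto simp: digraph_def)
  have finK: "finite ?K"
    by (rule finite_subset[of _ "V \<times> V"]) (use finV in auto)
  have AK: "A \<subseteq> ?K" using A by (auto simp: digraph_def)
  have cN: "card ?N + card A = n * (n - 1)"
    using card_Diff_subset[OF finA AK] card_mono[OF finK AK] card_arcs[OF finV n(1)] by simp
  have cls_ne: "cls k \<noteq> {}" if "k \<in> C ` A" for k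
    using that by (auto simp: cls_def)
  have cls_dig: "digraph V (cls k)" for k
    by (rule digraph_subset[OF A]) (auto simp: cls_def)
  have cls_pos: "1 \<le> card (cls k)" if "k \<in> C ` A" for k
    using cls_ne[OF that] finA by (simp add: cls_def Suc_leI card_gt_0_iff)
  have sum_cls: "(\<Sum>k\<in>C ` A. card (cls k)) = card A"
    unfolding cls_def using sum.image_gen[OF finA, of "\<lambda>_. 1::nat" C] by simp
  \<comment> \<open>Every class has at least one arc and each of the \<open>q\<close> large ones at
    least \<open>w\<close>; with \<open>few\<close> this leaves at most one large class.\<close>
  have "q * (w - 1) + num_colors A C \<le> card A"
  proof -
    have "q * (w - 1) + num_colors A C =
        (\<Sum>k\<in>C ` A. of_bool (w \<le> card (cls k)) * (w - 1) + 1)"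
      unfolding q_def num_colors_def using finA
      by (simp only: card_filter_eq_sum_of_bool finite_imageI sum.distrib sum_distrib_right) simp
    also have "\<dots> \<le> (\<Sum>k\<in>C ` A. card (cls k))"
      by (rule sum_mono) (use cls_pos in force)
    finally show ?thesis using sum_cls by simp
  qed
  with few have "q * (w - 1) < 2 * (w - 1)" by linarith
  then have q: "q \<le> 1" by simp
  \<comment> \<open>For a class of m arcs below \<open>w\<close>, the odd triples improve the bound
    3rm to 3r(m - 1). A large class forgoes this gain, which the last summand records; subtraction
    is avoided.\<close>
  have dbl: "2 * double_triples V (cls k) + 3 * r \<le>
      3 * (r * card (cls k)) + 3 * (r * of_bool (w \<le> card (cls k)))" if "k \<in> C ` A" for k
    using double_odd_triples[OF cls_dig n(1), of k] w[OF cls_dig cls_ne[OF that]]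
    unfolding r_def by (cases "w \<le> card (cls k)") auto
  have "2 * (\<Sum>k\<in>C ` A. double_triples V (cls k)) + 3 * r * num_colors A C =
      (\<Sum>k\<in>C ` A. 2 * double_triples V (cls k) + 3 * r)"
    unfolding num_colors_def by (simp add: sum.distrib sum_distrib_left)
  also have "\<dots> \<le> (\<Sum>k\<in>C ` A. 3 * (r * card (cls k)) + 3 * (r * of_bool (w \<le> card (cls k))))"
    by (rule sum_mono) (rule dbl)
  also have "\<dots> = 3 * (r * card A) + 3 * (r * q)"
    unfolding q_def sum_cls[symmetric] card_filter_eq_sum_of_bool[OF finite_imageI[OF finA]]
    by (simp only: sum.distrib sum_distrib_left)
  also have "\<dots> \<le> 3 * (r * card A) + 3 * r"
    using q by simp
  finally have D: "2 * (\<Sum>k\<in>C ` A. double_triples V (cls k)) + 3 * r * num_colors A C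
      \<le> 3 * (r * card A) + 3 * r" .
  let ?U = "{t \<in> triples V. 1 \<le> hits ?N t}"
  let ?D = "\<lambda>k. {t \<in> triples V. 2 \<le> hits (cls k) t}"
  have fT: "finite (triples V)" by (rule finite_triples[OF finV])
  \<comment> \<open>A triple without non-arcs is a directed triangle; not being rainbow, it has two
    arcs of one colour.\<close>
  have "triples V \<subseteq> ?U \<union> (\<Union>k\<in>C ` A. ?D k)"
  proof
    fix t assume t: "t \<in> triples V"
    obtain x y z where xyz: "t = (x, y, z)" by (cases t)
    show "t \<in> ?U \<union> (\<Union>k\<in>C ` A. ?D k)"
    proof (cases "(x, y) \<in> A \<and> (y, z) \<in> A \<and> (z, x) \<in> A")
      case True
      then have "C (x, y) = C (y, z) \<or> C (y, z) = C (z, x) \<or> C (x, y) = C (z, x)"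
        using nr unfolding has_rainbow_triangle_def by blast
      then have "\<exists>k\<in>C ` A. 2 \<le> hits (cls k) t"
      proof (elim disjE)
        assume "C (x, y) = C (y, z)"
        with True show ?thesis
          unfolding xyz by (intro bexI[of _ "C (x, y)"]) (auto simp: cls_def)
      next
        assume "C (y, z) = C (z, x)"
        with True show ?thesis
          unfolding xyz by (intro bexI[of _ "C (y, z)"]) (auto simp: cls_def)
      next
        assume "C (x, y) = C (z, x)"
        with True show ?thesis
          unfolding xyz by (intro bexI[of _ "C (x, y)"]) (auto simp: cls_def)
      qed
      with t show ?thesis by blast
    next
      case False
      with t show ?thesis unfolding xyz by (auto simp: triples_def)
    qed
  qed
  then have "card (triples V) \<le> card (?U \<union> (\<Union>k\<in>C ` A. ?D k))"
    using fT finA by (intro card_mono) auto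
  also have "\<dots> \<le> card ?U + card (\<Union>k\<in>C ` A. ?D k)"
    by (rule card_Un_le)
  also have "card (\<Union>k\<in>C ` A. ?D k) \<le> (\<Sum>k\<in>C ` A. double_triples V (cls k))"
    unfolding double_triples_def using finA by (intro card_UN_le) simp
  also have "card ?U \<le> (\<Sum>t\<in>triples V. hits ?N t)"
    unfolding card_filter_eq_sum_of_bool[OF fT] by (rule sum_mono) auto
  also have "\<dots> = 3 * (r * card ?N)"
    unfolding r_def by (rule sum_hits) (use finV n in \<open>auto simp: digraph_def\<close>)
  finally have "r * (n * (n - 1)) \<le>
      3 * (r * card ?N) + (\<Sum>k\<in>C ` A. double_triples V (cls k))"
    using card_triples[OF finV n(1)] by (simp add: r_def)
  with D have "r * (2 * (n * (n - 1)) + 3 * num_colors A C)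
      \<le> r * (6 * card ?N + 3 * card A + 3)"
    by (simp add: algebra_simps)
  then have "2 * (n * (n - 1)) + 3 * num_colors A C \<le> 6 * card ?N + 3 * card A + 3"
    using n by (simp add: r_def)
  \<comment> \<open>Eliminates the number b of non-arcs through b = k - a, where k is
    \<open>n * (n - 1)\<close>.\<close>
  moreover have "3 * (a + c) \<le> 4 * k + 3" if "b + a = k" "2 * k + 3 * c \<le> 6 * b + 3 * a + 3"
    for a b c k :: nat
    using that by simp
  ultimately show ?thesis using cN by blast
qed

text \<open>For n = 3, 4, 5 the counting bound gives at most 9, 17, 27, against the assumed 11, 19,
  28. As there are at most \<open>n * (n - 1)\<close> arcs, the number of colours is at least 5, 7,
  8, which yields the premise \<open>few\<close>.\<close>

lemma rainbow_triangle_small: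
  assumes "digraph V A" "card V = n" "n \<in> {3, 4, 5}"
    and ge: "card A + num_colors A C \<ge>
           (if n \<le> 4 then n * (n - 1) + (n ^ 2) div 4 + 3
            else n * (n - 1) + (n ^ 2) div 4 + 2)"
  shows "has_rainbow_triangle A C"
proof (rule ccontr)
  assume nr: "\<not> has_rainbow_triangle A C"
  have le: "card A \<le> n * (n - 1)" by (rule card_digraph_le) fact+
  consider "n = 3" | "n = 4" | "n = 5" using assms(3) by blast
  then show False
  proof cases
    case 1
    then show False
      using arcs_plus_colors_le[OF assms(1,2) _ nr, of 2] odd_triples_3[of V] assms(2) le ge by simp
  next
    case 2
    then show False
      using arcs_plus_colors_le[OF assms(1,2) _ nr, of 4] odd_triples_4[of V] assms(2) le ge by simp
  next
    case 3
    then show False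
      using arcs_plus_colors_le[OF assms(1,2) _ nr, of 8] odd_triples_5[of V] assms(2) le ge by simp
  qed
qed

section \<open>Averaging over vertex deletions\<close>

definition delete_vertex :: "'a \<Rightarrow> ('a \<times> 'a) set \<Rightarrow> ('a \<times> 'a) set" where
  "delete_vertex v A = {(x, y) \<in> A. x \<noteq> v \<and> y \<noteq> v}"

lemma digraph_delete_vertex: "digraph V A \<Longrightarrow> digraph (V - {v}) (delete_vertex v A)"
  by (auto simp: digraph_def delete_vertex_def)

lemma rainbow_delete_vertex:
  "has_rainbow_triangle (delete_vertex v A) C \<Longrightarrow> has_rainbow_triangle A C"
  by (auto simp: has_rainbow_triangle_def delete_vertex_def)

text \<open>An arc is lost only when one of its two ends is deleted.\<close>

lemma sum_card_delete_vertex: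
  assumes A: "digraph V A"
  shows "(\<Sum>v\<in>V. card (delete_vertex v A)) = (card V - 2) * card A"
proof -
  have finV: "finite V" and finA: "finite A"
    using A digraph_finite_arcs by (auto simp: digraph_def)
  have "(\<Sum>v\<in>V. card (delete_vertex v A)) =
      (\<Sum>v\<in>V. \<Sum>p\<in>A. of_bool (fst p \<noteq> v \<and> snd p \<noteq> v))"
    unfolding delete_vertex_def card_filter_eq_sum_of_bool[OF finA, symmetric]
    by (simp add: case_prod_unfold)
  also have "\<dots> = (\<Sum>p\<in>A. \<Sum>v\<in>V. of_bool (fst p \<noteq> v \<and> snd p \<noteq> v))"
    by (rule sum.swap)
  also have "\<dots> = (\<Sum>p\<in>A. card V - 2)"
  proof (rule sum.cong)
    fix p assume "p \<in> A"
    then have p: "{fst p, snd p} \<subseteq> V" "fst p \<noteq> snd p"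
      using A by (auto simp: digraph_def)
    have "(\<Sum>v\<in>V. of_bool (fst p \<noteq> v \<and> snd p \<noteq> v)) = card (V - {fst p, snd p})"
      unfolding card_filter_eq_sum_of_bool[OF finV, symmetric]
      by (intro arg_cong[where f = card]) auto
    also have "\<dots> = card V - 2"
      using p by (subst card_Diff_subset) auto
    finally show "(\<Sum>v\<in>V. of_bool (fst p \<noteq> v \<and> snd p \<noteq> v)) = card V - 2" .
  qed simp
  finally show ?thesis by simp
qed

lemma num_colors_delete_vertex:
  assumes A: "digraph V A"
  shows "(\<Sum>v\<in>V. num_colors (delete_vertex v A) C) =
    (\<Sum>k\<in>C ` A. card {v \<in> V. k \<in> C ` delete_vertex v A})"
proof -
  have finV: "finite V" and finI: "finite (C ` A)"
    using A digraph_finite_arcs by (auto simp: digraph_def)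
  have "num_colors (delete_vertex v A) C = card {k \<in> C ` A. k \<in> C ` delete_vertex v A}" for v
    unfolding num_colors_def by (rule arg_cong[where f = card]) (auto simp: delete_vertex_def)
  then show ?thesis
    unfolding card_filter_eq_sum_of_bool[OF finI] card_filter_eq_sum_of_bool[OF finV]
    by (simp only:) (rule sum.swap)
qed

text \<open>One arc of colour \<open>k\<close> survives all deletions but those of its ends. A
  second arc on another vertex pair also survives the deletion of some end of the first, hence the
  strict bound.\<close>

lemma card_color_survives:
  assumes A: "digraph V A" and p: "(x, y) \<in> A" "C (x, y) = k"
  shows "card V - 2 \<le> card {v \<in> V. k \<in> C ` delete_vertex v A}"
    and "(x', y') \<in> A \<Longrightarrow> C (x', y') = k \<Longrightarrow> {x', y'} \<noteq> {x, y}
      \<Longrightarrow> card V - 2 < card {v \<in> V. k \<in> C ` delete_vertex v A}"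
proof -
  let ?S = "{v \<in> V. k \<in> C ` delete_vertex v A}"
  have fin: "finite V" using A by (simp add: digraph_def)
  have sub: "V - {u, v} \<subseteq> ?S" if "(u, v) \<in> A" "C (u, v) = k" for u v
    using that by (force simp: delete_vertex_def)
  have xy: "x \<noteq> y" "{x, y} \<subseteq> V" using A p by (auto simp: digraph_def)
  then have cd: "card (V - {x, y}) = card V - 2" by (subst card_Diff_subset) auto
  then show "card V - 2 \<le> card ?S"
    using card_mono[OF _ sub[OF p]] fin by simp
  assume p': "(x', y') \<in> A" "C (x', y') = k" "{x', y'} \<noteq> {x, y}"
  then have "x' \<noteq> y'" using A by (auto simp: digraph_def)
  then obtain u where u: "u \<in> {x, y}" "u \<notin> {x', y'}"
    using p'(3) xy(1) by blast
  then have "u \<in> ?S - (V - {x, y})"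
    using sub[OF p'(1,2)] xy(2) by auto
  then have "V - {x, y} \<subset> ?S" using sub[OF p] by blast
  then show "card V - 2 < card ?S"
    using cd psubset_card_mono[of ?S "V - {x, y}"] fin by simp
qed

text \<open>The strict part serves the equality case: if equality holds, arcs of the same colour
  join the same two vertices.\<close>

lemma sum_num_colors_delete_vertex:
  assumes A: "digraph V A"
  shows "(card V - 2) * num_colors A C \<le> (\<Sum>v\<in>V. num_colors (delete_vertex v A) C)"
    and "(x, y) \<in> A \<Longrightarrow> (x', y') \<in> A \<Longrightarrow> C (x', y') = C (x, y) \<Longrightarrow> {x', y'} \<noteq> {x, y}
      \<Longrightarrow> (card V - 2) * num_colors A C < (\<Sum>v\<in>V. num_colors (delete_vertex v A) C)"
proof -
  have eq: "(card V - 2) * num_colors A C = (\<Sum>k\<in>C ` A. card V - 2)"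
    by (simp add: num_colors_def)
  have le: "card V - 2 \<le> card {v \<in> V. k \<in> C ` delete_vertex v A}" if "k \<in> C ` A" for k
    using that card_color_survives(1)[OF A] by fastforce
  show "(card V - 2) * num_colors A C \<le> (\<Sum>v\<in>V. num_colors (delete_vertex v A) C)"
    unfolding eq num_colors_delete_vertex[OF A] by (rule sum_mono) (rule le)
  assume "(x, y) \<in> A" "(x', y') \<in> A" "C (x', y') = C (x, y)" "{x', y'} \<noteq> {x, y}"
  then have "\<exists>k\<in>C ` A. card V - 2 < card {v \<in> V. k \<in> C ` delete_vertex v A}"
    using card_color_survives(2)[OF A, of x y C "C (x, y)" x' y'] by blast
  then show "(card V - 2) * num_colors A C < (\<Sum>v\<in>V. num_colors (delete_vertex v A) C)"
    unfolding eq num_colors_delete_vertex[OF A]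
    using digraph_finite_arcs[OF A] le by (intro sum_strict_mono_ex1) auto
qed

section \<open>Digraphs without directed triangles\<close>

definition triangle_free :: "('a \<times> 'a) set \<Rightarrow> bool" where
  "triangle_free A \<longleftrightarrow> \<not> (\<exists>x y z. (x, y) \<in> A \<and> (y, z) \<in> A \<and> (z, x) \<in> A)"

lemma triangle_free_delete_vertex: "triangle_free A \<Longrightarrow> triangle_free (delete_vertex v A)"
  unfolding triangle_free_def delete_vertex_def by blast

text \<open>Give all arcs different colours: 14 arcs would make arcs plus colours at least 28 and
  force a rainbow triangle.\<close>

lemma triangle_free_card_5:
  assumes "digraph V A" "card V = 5" "triangle_free A"
  shows "card A \<le> 13"
proof (rule ccontr)
  assume "\<not> card A \<le> 13"
  obtain C :: "'a \<times> 'a \<Rightarrow> nat" where "inj_on C A"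
    using digraph_finite_arcs[OF assms(1)] finite_imp_inj_to_nat_seg by metis
  then have "num_colors A C = card A"
    unfolding num_colors_def by (rule card_image)
  then have "has_rainbow_triangle A C"
    using rainbow_triangle_small[OF assms(1,2), of C] \<open>\<not> card A \<le> 13\<close> by simp
  then show False
    using assms(3) unfolding triangle_free_def has_rainbow_triangle_def by blast
qed

lemma triangle_free_card_step:
  fixes V :: "'a set"
  assumes A: "digraph V A" "triangle_free A" and n: "card V = Suc n"
    and IH: "\<And>(W :: 'a set) B. digraph W B \<Longrightarrow> card W = n \<Longrightarrow> triangle_free B \<Longrightarrow> card B \<le> b"
  shows "(n - 1) * card A \<le> Suc n * b"
proof -
  have "(n - 1) * card A = (\<Sum>v\<in>V. card (delete_vertex v A))"
    using sum_card_delete_vertex[OF A(1)] n by simp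
  also have "\<dots> \<le> (\<Sum>v\<in>V. b)"
    by (intro sum_mono IH[OF digraph_delete_vertex[OF A(1)] _ triangle_free_delete_vertex[OF A(2)]])
      (use n in auto)
  finally show ?thesis using n by simp
qed

text \<open>Averaging with rounding down takes 13 to 6 * 13 / 4, hence 19, and then to 7 * 19 / 5,
  hence 26.\<close>

lemma triangle_free_card_7:
  assumes "digraph V A" "card V = 7" "triangle_free A"
  shows "card A \<le> 26"
proof -
  have 6: "card B \<le> 19" if "digraph W B" "card W = 6" "triangle_free B" for W :: "'a set" and B
  proof -
    have "(5 - 1) * card B \<le> Suc 5 * 13"
      by (rule triangle_free_card_step[OF that(1,3)])
        (simp add: that(2), erule (2) triangle_free_card_5)
    then show ?thesis by simp
  qed
  have "(6 - 1) * card A \<le> Suc 6 * 19"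
    by (rule triangle_free_card_step[OF assms(1,3)]) (simp add: assms(2), erule (2) 6)
  then show ?thesis by simp
qed

text \<open>Since \<open>s\<close> is an integer, dividing by \<open>n - 1\<close> and rounding
  gives the target bound, except for n = 6, where 5 * 56 = 7 * 40 allows one more.\<close>

lemma arcs_plus_colors_step:
  assumes "5 \<le> n" "(n - 1) * s \<le> Suc n * (n * (n - 1) + n ^ 2 div 4 + 1)"
  shows "s \<le> Suc n * n + (Suc n) ^ 2 div 4 + 1 \<or> n = 6 \<and> s = 56"
proof (rule ccontr)
  assume "\<not> ?thesis"
  then have s: "Suc n * n + (Suc n) ^ 2 div 4 + 2 \<le> s" "n = 6 \<Longrightarrow> s \<noteq> 56" by auto
  show False
  proof (cases "even n")
    case True
    then obtain k where k: "n = 2 * k" by blast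
    have k3: "k \<ge> 3" using assms(1) k by simp
    have 1: "n ^ 2 div 4 = k ^ 2" "(Suc n) ^ 2 div 4 = k ^ 2 + k"
      unfolding k by (auto simp: power2_eq_square algebra_simps)
    \<comment> \<open>Rids \<open>2 * k - 1\<close> of truncated subtraction for the algebra
      below.\<close>
    obtain j where j: "k = Suc j" using k3 by (cases k) auto
    have s': "s \<ge> (2 * k + 1) * (2 * k) + k ^ 2 + k + 2"
      using s(1) unfolding 1 unfolding k by simp
    have "(2 * k - 1) * s \<le> (2 * k + 1) * (2 * k * (2 * k - 1) + k ^ 2 + 1)"
      using assms(2) unfolding 1 unfolding k by simp
    moreover have "(2 * k - 1) * ((2 * k + 1) * (2 * k) + k ^ 2 + k + 2) + 3 =
        (2 * k + 1) * (2 * k * (2 * k - 1) + k ^ 2 + 1) + k"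
      unfolding j by (simp add: power2_eq_square algebra_simps)
    moreover have "(2 * k - 1) * ((2 * k + 1) * (2 * k) + k ^ 2 + k + 2) \<le> (2 * k - 1) * s"
      using s' by (rule mult_le_mono2)
    \<comment> \<open>The last three facts together give k <= 3.\<close>
    ultimately have "k = 3" using k3 by linarith
    then show False
      using assms(2) s(2) s' k by simp
  next
    case False
    then obtain k where k: "n = 2 * k + 1" by (elim oddE)
    have k2: "k \<ge> 2" using assms(1) k by simp
    have 1: "n ^ 2 div 4 = k ^ 2 + k" "(Suc n) ^ 2 div 4 = k ^ 2 + 2 * k + 1"
      unfolding k by (auto simp: power2_eq_square algebra_simps)
    have s': "s \<ge> (2 * k + 2) * (2 * k + 1) + k ^ 2 + 2 * k + 3"
      using s(1) unfolding 1 unfolding k by simp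
    have "2 * k * s \<le> (2 * k + 2) * ((2 * k + 1) * (2 * k) + k ^ 2 + k + 1)"
      using assms(2) unfolding 1 unfolding k by simp
    moreover have "2 * k * ((2 * k + 2) * (2 * k + 1) + k ^ 2 + 2 * k + 3) + 2 =
        (2 * k + 2) * ((2 * k + 1) * (2 * k) + k ^ 2 + k + 1) + 2 * k"
      by (simp add: power2_eq_square algebra_simps)
    moreover have "2 * k * ((2 * k + 2) * (2 * k + 1) + k ^ 2 + 2 * k + 3) \<le> 2 * k * s"
      using s' by (rule mult_le_mono2)
    ultimately show False using k2 by linarith
  qed
qed

lemma arcs_plus_colors_le_large:
  assumes "digraph V A" "card V = n" "5 \<le> n" "\<not> has_rainbow_triangle A C"
  shows "card A + num_colors A C \<le> n * (n - 1) + n ^ 2 div 4 + 1"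
  using assms(3,1,2,4)
proof (induction n arbitrary: V A rule: dec_induct)
  case base
  show ?case
  proof (rule ccontr)
    assume "\<not> ?case"
    then have "has_rainbow_triangle A C"
      by (intro rainbow_triangle_small[OF base(1,2)]) simp_all
    with base(3) show False ..
  qed
next
  case (step n)
  let ?B = "n * (n - 1) + n ^ 2 div 4 + 1"
  let ?s = "card A + num_colors A C"
  let ?d = "\<lambda>v. card (delete_vertex v A) + num_colors (delete_vertex v A) C"
  have "?d v \<le> ?B" if "v \<in> V" for v
    by (rule step.IH[OF digraph_delete_vertex[OF step.prems(1)]])
      (use that step.prems rainbow_delete_vertex[of v A C] in auto)
  then have "(\<Sum>v\<in>V. ?d v) \<le> (\<Sum>v\<in>V. ?B)"
    by (rule sum_mono)
  then have le: "(n - 1) * card A + (\<Sum>v\<in>V. num_colors (delete_vertex v A) C) \<le> Suc n * ?B"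
    using sum_card_delete_vertex[OF step.prems(1)] step.prems(2) by (simp add: sum.distrib)
  with sum_num_colors_delete_vertex(1)[OF step.prems(1), of C] step.prems(2)
  have "(n - 1) * ?s \<le> Suc n * ?B"
    by (simp add: distrib_left)
  from arcs_plus_colors_step[OF step.hyps(1) this]
  consider "?s \<le> Suc n * n + (Suc n)\<^sup>2 div 4 + 1" | "n = 6" "?s = 56" by blast
  then show ?case
  proof cases
    case 1
    then show ?thesis by simp
  next
    case 2
    \<comment> \<open>Equality in the averaging: each colour class is contained in a 2-cycle, so every
      directed triangle would be rainbow.\<close>
    have pair: "{x', y'} = {x, y}"
      if "(x, y) \<in> A" "(x', y') \<in> A" "C (x', y') = C (x, y)" for x y x' y'
    proof (rule ccontr)
      assume "{x', y'} \<noteq> {x, y}"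
      \<comment> \<open>Here \<open>le\<close> has right-hand side 7 * 40 = 5 * 56, which leaves no
        room for a strict inequality.\<close>
      from sum_num_colors_delete_vertex(2)[OF step.prems(1) that this] show False
        using le 2 step.prems(2) by simp
    qed
    have "triangle_free A"
      unfolding triangle_free_def
    proof clarify
      fix x y z assume xyz: "(x, y) \<in> A" "(y, z) \<in> A" "(z, x) \<in> A"
      then have "x \<noteq> y" "y \<noteq> z" "z \<noteq> x" using step.prems(1) by (auto simp: digraph_def)
      then have "C (x, y) \<noteq> C (y, z)" "C (y, z) \<noteq> C (z, x)" "C (x, y) \<noteq> C (z, x)"
        using pair xyz by (metis doubleton_eq_iff)+
      then show False
        using xyz step.prems(3) unfolding has_rainbow_triangle_def by blast
    qed
    then have "card A \<le> 26"
      using triangle_free_card_7[OF step.prems(1)] step.prems(2) 2 by simp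
    \<comment> \<open>Arcs and colours together number at most 52, contradicting 56.\<close>
    moreover have "num_colors A C \<le> card A"
      unfolding num_colors_def by (rule card_image_le[OF digraph_finite_arcs[OF step.prems(1)]])
    ultimately show ?thesis using 2 by simp
  qed
qed

theorem theorem3:
  fixes V :: "'a set" and A :: "('a \<times> 'a) set" and C :: "'a \<times> 'a \<Rightarrow> nat" and n :: nat
  assumes "digraph V A"
    and "card V = n" and "n \<ge> 3"
    and "card A + num_colors A C \<ge>
           (if n \<le> 4 then n * (n - 1) + (n ^ 2) div 4 + 3
            else n * (n - 1) + (n ^ 2) div 4 + 2)"
  shows "has_rainbow_triangle A C"
proof (cases "n \<le> 4")
  case True
  then have "n \<in> {3, 4, 5}" using assms(3) by auto
  from rainbow_triangle_small[OF assms(1,2) this assms(4)] show ?thesis .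
next
  case False
  then show ?thesis
    using arcs_plus_colors_le_large[OF assms(1,2), of C] assms(4) by fastforce
qed

end
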